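(* Let $d\ge 1$, let $f^1,\dots,f^d:\mathbb{R}^{2d}\to\mathbb{R}$ be smooth real-valued functions, identify $\mathbb{R}^{2d}\cong\mathbb{C}^d$ via $u^n=x^{2n-1}+i\,x^{2n}$, and let $\Sigma=\{x\in\mathbb{R}^{2d} : f^m(x)=0,\ m=1,\dots,d\}$. Let $M=\left(\frac{\partial f^m}{\partial u^n}\right)_{m,n=1}^d$ and $\bar M=\left(\frac{\partial f^m}{\partial \bar u^n}\right)_{m,n=1}^d$, suppose that $M$ is invertible at every point of $\Sigma$, and on $\Sigma$ put $N=(-1)^d\,\bar M^{-1}M$. Then the $d$-cycle $\Sigma$ is supersymmetric if and only if, at every point of $\Sigma$, $\{f^m,f^n\}=0$ for all $m,n\in\{1,\dots,d\}$ and $\det N=1$.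
   Context: The partial derivatives with respect to $u^n$ and $\bar u^n$ are the Wirtinger derivatives $\frac{\partial}{\partial u^n}=\frac12\left(\frac{\partial}{\partial x^{2n-1}}-i\frac{\partial}{\partial x^{2n}}\right)$ and $\frac{\partial}{\partial \bar u^n}=\frac12\left(\frac{\partial}{\partial x^{2n-1}}+i\frac{\partial}{\partial x^{2n}}\right)$. Since the $f^m$ are real-valued, $\bar M$ is the entrywise complex conjugate of $M$. Invertibility of $M$ along $\Sigma$ makes the differentials $df^1,\dots,df^d$ linearly independent along $\Sigma$, so $\Sigma$ is a $d$-dimensional embedded submanifold; write $i:\Sigma\to\mathbb{C}^d$ for the inclusion. A $d$-dimensional submanifold $i:\Sigma\to\mathbb{C}^d$ is called supersymmetric (equivalently, special Lagrangian) if $i^*\omega=0$ and $i^*(\operatorname{Im}\Omega)=0$, where $\omega=\frac{1}{2i}\sum_{n=1}^d du^n\wedge d\bar u^n$ (with $i$ the imaginary unit in the prefactor) and $\Omega=du^1\wedge\dots\wedge du^d$. The Poisson bracket of smooth functions $f,g$ on $\mathbb{R}^{2d}$ is $\{f,g\}=\sum_{k=1}^d\left(\frac{\partial f}{\partial x^{2k-1}}\frac{\partial g}{\partial x^{2k}}-\frac{\partial f}{\partial x^{2k}}\frac{\partial g}{\partial x^{2k-1}}\right)$. *)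

theory Defs
  imports "HOL-Analysis.Analysis"
begin

text \<open>
  The space is \<^typ>\<open>complex ^ 'n\<close> with \<open>d = CARD('n)\<close>. The real coordinates are
  \<open>x\<^sup>2\<^sup>n\<^sup>-\<^sup>1 = Re (u $ n)\<close> and \<open>x\<^sup>2\<^sup>n = Im (u $ n)\<close>, so the coordinate vectors are \<open>axis n 1\<close> and
  \<open>axis n \<i>\<close>; differentiability, subspaces and dimensions are all over the reals.
\<close>

subsection \<open>Smooth maps, embedded submanifolds, tangent vectors\<close>

text \<open>Class \<open>C\<^sup>k\<close> and smoothness; intended for open domains only.\<close>

primrec Ck_on :: "nat \<Rightarrow> 'a::real_normed_vector set \<Rightarrow> ('a \<Rightarrow> 'b::real_normed_vector) \<Rightarrow> bool" where
  "Ck_on 0 S f \<longleftrightarrow> continuous_on S f"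
| "Ck_on (Suc k) S f \<longleftrightarrow>
     (\<forall>x\<in>S. f differentiable (at x)) \<and> (\<forall>v. Ck_on k S (\<lambda>x. frechet_derivative f (at x) v))"

definition smooth_on :: "'a::real_normed_vector set \<Rightarrow> ('a \<Rightarrow> 'b::real_normed_vector) \<Rightarrow> bool" where
  "smooth_on S f \<longleftrightarrow> (\<forall>k. Ck_on k S f)"

definition embedded_submanifold :: "nat \<Rightarrow> 'a::euclidean_space set \<Rightarrow> bool" where
  "embedded_submanifold k S \<longleftrightarrow>
     (\<forall>p\<in>S. \<exists>U V L (\<phi> :: 'a \<Rightarrow> 'a) \<psi>.
        open U \<and> p \<in> U \<and> open V \<and> subspace L \<and> dim L = k \<and>
        homeomorphism U V \<phi> \<psi> \<and> smooth_on U \<phi> \<and> smooth_on V \<psi> \<and>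
        \<phi> ` (S \<inter> U) = V \<inter> L)"

definition tangent_space :: "'a::real_normed_vector set \<Rightarrow> 'a \<Rightarrow> 'a set" where
  "tangent_space S p =
     {v. \<exists>\<gamma> \<epsilon>. \<epsilon> > (0::real) \<and> smooth_on {-\<epsilon><..<\<epsilon>} \<gamma> \<and> \<gamma> ` {-\<epsilon><..<\<epsilon>} \<subseteq> S \<and>
                \<gamma> 0 = p \<and> (\<gamma> has_vector_derivative v) (at 0)}"

subsection \<open>Partial derivatives and the Poisson bracket\<close>

definition partial_re :: "'n::finite \<Rightarrow> (complex ^ 'n \<Rightarrow> real) \<Rightarrow> complex ^ 'n \<Rightarrow> real" where
  "partial_re n f x = deriv (\<lambda>t::real. f (x + t *\<^sub>R axis n 1)) 0"

definition partial_im :: "'n::finite \<Rightarrow> (complex ^ 'n \<Rightarrow> real) \<Rightarrow> complex ^ 'n \<Rightarrow> real" where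
  "partial_im n f x = deriv (\<lambda>t::real. f (x + t *\<^sub>R axis n \<i>)) 0"

definition wirtinger :: "'n::finite \<Rightarrow> (complex ^ 'n \<Rightarrow> real) \<Rightarrow> complex ^ 'n \<Rightarrow> complex" where
  "wirtinger n f x = 1/2 * (complex_of_real (partial_re n f x) - \<i> * complex_of_real (partial_im n f x))"

definition wirtinger_bar :: "'n::finite \<Rightarrow> (complex ^ 'n \<Rightarrow> real) \<Rightarrow> complex ^ 'n \<Rightarrow> complex" where
  "wirtinger_bar n f x = 1/2 * (complex_of_real (partial_re n f x) + \<i> * complex_of_real (partial_im n f x))"

definition poisson ::
    "(complex ^ 'n::finite \<Rightarrow> real) \<Rightarrow> (complex ^ 'n \<Rightarrow> real) \<Rightarrow> complex ^ 'n \<Rightarrow> real" where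
  "poisson f g x =
     (\<Sum>k\<in>UNIV. partial_re k f x * partial_im k g x - partial_im k f x * partial_re k g x)"

definition M_mat :: "('n::finite \<Rightarrow> complex ^ 'n \<Rightarrow> real) \<Rightarrow> complex ^ 'n \<Rightarrow> complex ^ 'n ^ 'n" where
  "M_mat f x = (\<chi> m n. wirtinger n (f m) x)"

definition Mbar_mat :: "('n::finite \<Rightarrow> complex ^ 'n \<Rightarrow> real) \<Rightarrow> complex ^ 'n \<Rightarrow> complex ^ 'n ^ 'n" where
  "Mbar_mat f x = (\<chi> m n. wirtinger_bar n (f m) x)"

definition N_mat :: "('n::finite \<Rightarrow> complex ^ 'n \<Rightarrow> real) \<Rightarrow> complex ^ 'n \<Rightarrow> complex ^ 'n ^ 'n" where
  "N_mat f x = (-1) ^ CARD('n) *\<^sub>R (matrix_inv (Mbar_mat f x) ** M_mat f x)"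

subsection \<open>Supersymmetric submanifolds\<close>

text \<open>
  The forms below have constant coefficients, so they are given as alternating forms on
  \<^typ>\<open>complex ^ 'n\<close>. The form \<open>du\<^sup>1 \<and> \<dots> \<and> du\<^sup>d\<close> takes a family of vectors indexed by
  \<open>'n\<close>; using the same index type for the factors and for the arguments, no ordering of \<open>'n\<close>
  has to be chosen.
\<close>

definition du :: "'n::finite \<Rightarrow> complex ^ 'n \<Rightarrow> complex" where
  "du n v = v $ n"

definition du_bar :: "'n::finite \<Rightarrow> complex ^ 'n \<Rightarrow> complex" where
  "du_bar n v = cnj (v $ n)"

definition wedge2 :: "('a \<Rightarrow> complex) \<Rightarrow> ('a \<Rightarrow> complex) \<Rightarrow> 'a \<Rightarrow> 'a \<Rightarrow> complex" where
  "wedge2 \<alpha> \<beta> v w = \<alpha> v * \<beta> w - \<alpha> w * \<beta> v"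

definition wedge_all :: "('n::finite \<Rightarrow> 'a \<Rightarrow> complex) \<Rightarrow> ('n \<Rightarrow> 'a) \<Rightarrow> complex" where
  "wedge_all \<alpha> vs = det (\<chi> n j. \<alpha> n (vs j))"

definition omega :: "complex ^ 'n::finite \<Rightarrow> complex ^ 'n \<Rightarrow> complex" where
  "omega v w = 1 / (2 * \<i>) * (\<Sum>n\<in>UNIV. wedge2 (du n) (du_bar n) v w)"

definition Omega :: "('n::finite \<Rightarrow> complex ^ 'n) \<Rightarrow> complex" where
  "Omega vs = wedge_all du vs"

text \<open>
  The pullback of a form along the inclusion vanishes iff the form vanishes on all tuples of
  vectors of each tangent space.
\<close>

definition supersymmetric :: "(complex ^ 'n::finite) set \<Rightarrow> bool" where
  "supersymmetric S \<longleftrightarrow>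
     embedded_submanifold CARD('n) S \<and>
     (\<forall>p\<in>S. \<forall>v\<in>tangent_space S p. \<forall>w\<in>tangent_space S p. omega v w = 0) \<and>
     (\<forall>p\<in>S. \<forall>vs. (\<forall>j. vs j \<in> tangent_space S p) \<longrightarrow> Im (Omega vs) = 0)"

end

(* The tangent space of the zero set at p is {v. Re (M v) = 0} = i M^-1 R^d. On it omega is
   represented by the imaginary part of (M^-1)^T conj(M^-1), whose inverse conj(M) M^T has the
   Poisson brackets (up to the factor -1/4) as imaginary part; and Omega takes the values
   (i^d / det M) r with r real, so that Im Omega vanishes iff (-1)^d det M / conj(det M) = 1.

   That the zero set is a submanifold with this tangent space needs a smooth inverse function
   theorem: if B(y) = Df(g y)^-1 is the derivative of the local inverse g, then
   D(B v)(y) h = - B(y) (D^2 f (g y) (B(y) v) (B(y) h)), so that g and B gain derivatives together. *)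

theory Submission
  imports Defs
begin

subsection \<open>Calculus of \<open>C\<^sup>k\<close> maps\<close>

text \<open>Openness carries the argument: agreement on \<open>S\<close> is agreement near every
  point of \<open>S\<close>, so the Frechet derivatives agree on \<open>S\<close> as well, and the
  induction passes to them.\<close>

lemma Ck_on_cong:
  assumes "open S" "\<And>x. x \<in> S \<Longrightarrow> f x = g x" "Ck_on k S f"
  shows "Ck_on k S g"
  using assms(2,3)
proof (induction k arbitrary: f g)
  case 0
  then show ?case using continuous_on_eq by auto
next
  case (Suc k)
  have *: "(g has_derivative frechet_derivative f (at x)) (at x)" if "x \<in> S" for x
  proof (rule has_derivative_transform_within_open[OF _ \<open>open S\<close> that])
    show "(f has_derivative frechet_derivative f (at x)) (at x)"
      using Suc.prems(2) that frechet_derivative_works by auto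
  qed (use Suc.prems in auto)
  show ?case
    unfolding Ck_on.simps
  proof (intro conjI allI ballI)
    fix v
    show "Ck_on k S (\<lambda>x. frechet_derivative g (at x) v)"
      by (rule Suc.IH[of "\<lambda>x. frechet_derivative f (at x) v"])
        (use Suc.prems(2) frechet_derivative_at[OF *] in auto)
  qed (use * differentiable_def in blast)
qed

text \<open>Lets a proof of class C^(k+1) work with an explicit formula \<open>f'\<close> for the
  derivative in place of \<open>frechet_derivative\<close>; every closure property below goes
  through it.\<close>

lemma Ck_on_SucI:
  assumes "open S" "\<And>x. x \<in> S \<Longrightarrow> (f has_derivative f' x) (at x)"
    and "\<And>v. Ck_on k S (\<lambda>x. f' x v)"
  shows "Ck_on (Suc k) S f"
  unfolding Ck_on.simps
proof (intro conjI allI ballI)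
  fix v
  show "Ck_on k S (\<lambda>x. frechet_derivative f (at x) v)"
    by (rule Ck_on_cong[OF \<open>open S\<close> _ assms(3)[of v]]) (use frechet_derivative_at[OF assms(2)] in auto)
qed (use assms(2) differentiable_def in blast)

lemma Ck_on_SucD_has_derivative:
  "Ck_on (Suc k) S f \<Longrightarrow> x \<in> S \<Longrightarrow> (f has_derivative frechet_derivative f (at x)) (at x)"
  using frechet_derivative_works by auto

lemma Ck_on_Suc_imp: "Ck_on (Suc k) S f \<Longrightarrow> Ck_on k S f"
proof (induction k arbitrary: f)
  case 0
  then show ?case
    by (simp add: differentiable_imp_continuous_within continuous_at_imp_continuous_on)
next
  case (Suc k)
  then show ?case by (metis Ck_on.simps(2))
qed

lemma Ck_on_subset: "Ck_on k S f \<Longrightarrow> T \<subseteq> S \<Longrightarrow> Ck_on k T f"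
  by (induction k arbitrary: f) (auto intro: continuous_on_subset)

lemma Ck_on_const: "open S \<Longrightarrow> Ck_on k S (\<lambda>x. c)"
proof (induction k arbitrary: c)
  case (Suc k)
  show ?case by (rule Ck_on_SucI[where f' = "\<lambda>x v. 0"]) (use Suc in auto)
qed auto

lemma Ck_on_bounded_linear_comp:
  assumes "open S" "bounded_linear h" "Ck_on k S f"
  shows "Ck_on k S (\<lambda>x. h (f x))"
  using assms(3)
proof (induction k arbitrary: f)
  case 0
  then show ?case using bounded_linear.continuous_on[OF assms(2)] by auto
next
  case (Suc k)
  show ?case
    by (rule Ck_on_SucI[OF \<open>open S\<close> bounded_linear.has_derivative[OF assms(2) Ck_on_SucD_has_derivative[OF Suc.prems]]])
      (use Suc in auto)
qed

lemma Ck_on_id: "open S \<Longrightarrow> Ck_on k S (\<lambda>x. x)"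
proof (cases k)
  case (Suc j)
  assume "open S"
  show ?thesis unfolding Suc
    by (rule Ck_on_SucI[where f' = "\<lambda>x v. v"]) (use \<open>open S\<close> Ck_on_const in auto)
qed auto

lemma Ck_on_add:
  assumes "open S" "Ck_on k S f" "Ck_on k S g"
  shows "Ck_on k S (\<lambda>x. f x + g x)"
  using assms(2,3)
proof (induction k arbitrary: f g)
  case 0
  then show ?case by (auto intro: continuous_intros)
next
  case (Suc k)
  show ?case
    by (rule Ck_on_SucI[OF \<open>open S\<close> has_derivative_add[OF Suc.prems[THEN Ck_on_SucD_has_derivative]]])
      (use Suc in auto)
qed

lemma Ck_on_sum:
  assumes "open S" "\<And>i. i \<in> I \<Longrightarrow> Ck_on k S (f i)"
  shows "Ck_on k S (\<lambda>x. \<Sum>i\<in>I. f i x)"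
  using assms(2)
  by (induction I rule: infinite_finite_induct) (auto intro: Ck_on_add Ck_on_const \<open>open S\<close>)

text \<open>By the product rule the derivative in a fixed direction is a sum of two products, each
  of a derivative of one factor with the other factor, so the claim for \<open>k\<close> applies
  once the undifferentiated factor is lowered to class C^k.\<close>

lemma (in bounded_bilinear) Ck_on:
  assumes "open S" "Ck_on k S f" "Ck_on k S g"
  shows "Ck_on k S (\<lambda>x. prod (f x) (g x))"
  using assms(2,3)
proof (induction k arbitrary: f g)
  case 0
  then show ?case by (auto intro: continuous_on)
next
  case (Suc k)
  show ?case
    by (rule Ck_on_SucI[OF \<open>open S\<close> FDERIV[OF Suc.prems[THEN Ck_on_SucD_has_derivative]]])
      (use Suc.prems in \<open>auto intro!: Ck_on_add \<open>open S\<close> Suc.IH Ck_on_Suc_imp[OF Suc.prems(1)]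
        Ck_on_Suc_imp[OF Suc.prems(2)]\<close>)
qed

lemmas Ck_on_scaleR = bounded_bilinear.Ck_on[OF bounded_bilinear_scaleR]

lemma linear_eq_sum_Basis:
  fixes h :: "'a::euclidean_space \<Rightarrow> 'b::real_vector"
  assumes "linear h"
  shows "h x = (\<Sum>b\<in>Basis. (x \<bullet> b) *\<^sub>R h b)"
  by (metis (no_types, lifting) assms euclidean_representation linear_scale linear_sum sum.cong)

text \<open>In the chain rule the direction fed to the derivative of \<open>F\<close> varies with
  \<open>x\<close>. Expanding it in \<open>Basis\<close> leaves scalar coefficients times
  derivatives of \<open>F\<close> in fixed directions, composed with \<open>g\<close>; the induction
  hypothesis, general in \<open>F\<close>, covers these.\<close>

lemma Ck_on_compose:
  fixes F :: "'b::euclidean_space \<Rightarrow> 'c::real_normed_vector"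
  assumes "open S" "open T" "Ck_on k T F" "Ck_on k S g" "g ` S \<subseteq> T"
  shows "Ck_on k S (\<lambda>x. F (g x))"
  using assms(3,4)
proof (induction k arbitrary: F)
  case 0
  then show ?case using \<open>g ` S \<subseteq> T\<close> continuous_on_compose2 by auto
next
  case (Suc k)
  have F: "(F has_derivative frechet_derivative F (at (g x))) (at (g x))" if "x \<in> S" for x
    using Ck_on_SucD_has_derivative[OF Suc.prems(1)] that \<open>g ` S \<subseteq> T\<close> by auto
  show ?case
  proof (rule Ck_on_SucI[OF \<open>open S\<close>])
    show "((\<lambda>x. F (g x)) has_derivative
        (\<lambda>v. \<Sum>b\<in>Basis. (frechet_derivative g (at x) v \<bullet> b) *\<^sub>R frechet_derivative F (at (g x)) b)) (at x)"
      if "x \<in> S" for x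
    proof -
      have "((\<lambda>x. F (g x)) has_derivative
          (\<lambda>v. frechet_derivative F (at (g x)) (frechet_derivative g (at x) v))) (at x)"
        using has_derivative_compose[OF Ck_on_SucD_has_derivative[OF Suc.prems(2) that] F[OF that]] .
      then show ?thesis
        by (subst (asm) linear_eq_sum_Basis[OF has_derivative_linear[OF F[OF that]]])
    qed
    show "Ck_on k S (\<lambda>x. \<Sum>b\<in>Basis. (frechet_derivative g (at x) v \<bullet> b) *\<^sub>R frechet_derivative F (at (g x)) b)"
      for v
    proof (intro Ck_on_sum Ck_on_scaleR \<open>open S\<close>)
      fix b :: 'b
      show "Ck_on k S (\<lambda>x. frechet_derivative g (at x) v \<bullet> b)"
        using Suc.prems(2)
        by (intro Ck_on_bounded_linear_comp[OF \<open>open S\<close> bounded_linear_inner_left]) auto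
      show "Ck_on k S (\<lambda>x. frechet_derivative F (at (g x)) b)"
        using Suc.IH[of "\<lambda>y. frechet_derivative F (at y) b"] Suc.prems Ck_on_Suc_imp by auto
    qed
  qed
qed

text \<open>A product rule asking only continuity of \<open>s\<close>: since \<open>r a = 0\<close>,
  the remainder is (r y - r a - r' (y - a)) s y + r' (y - a) (s y - s a), and both terms are o(|y -
  a|). It permits differentiating the inverse operator when only its continuity is known.\<close>

lemma has_derivative_scaleR_vanishing:
  fixes r :: "'a::real_normed_vector \<Rightarrow> real" and s :: "'a \<Rightarrow> 'b::real_normed_vector"
  assumes r: "(r has_derivative r') (at a)" and "r a = 0" and s: "isCont s a"
  shows "((\<lambda>x. r x *\<^sub>R s x) has_derivative (\<lambda>h. r' h *\<^sub>R s a)) (at a)"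
  unfolding has_derivative_iff_norm
proof
  have r0: "bounded_linear r'" using r has_derivative_bounded_linear by blast
  show "bounded_linear (\<lambda>h. r' h *\<^sub>R s a)"
    by (rule bounded_linear_compose[OF bounded_linear_scaleR_left r0])
  obtain K where K: "\<And>x. norm (r' x) \<le> norm x * K" using bounded_linear.bounded[OF r0] by blast
  have L: "((\<lambda>y. norm (r y - r a - r' (y - a)) / norm (y - a)) \<longlongrightarrow> 0) (at a)"
    using r unfolding has_derivative_iff_norm by blast
  have sl: "(s \<longlongrightarrow> s a) (at a)" using s isContD by blast
  have "((\<lambda>y. norm (r y - r a - r' (y - a)) / norm (y - a) * norm (s y) + K * norm (s y - s a))
      \<longlongrightarrow> 0 * norm (s a) + K * norm (s a - s a)) (at a)"
    by (intro tendsto_intros L sl)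
  then have lim: "((\<lambda>y. norm (r y - r a - r' (y - a)) / norm (y - a) * norm (s y) + K * norm (s y - s a))
      \<longlongrightarrow> 0) (at a)" by simp
  show "((\<lambda>y. norm (r y *\<^sub>R s y - r a *\<^sub>R s a - r' (y - a) *\<^sub>R s a) / norm (y - a)) \<longlongrightarrow> 0) (at a)"
  proof (rule tendsto_sandwich[OF _ _ tendsto_const lim])
    show "\<forall>\<^sub>F y in at a. norm (r y *\<^sub>R s y - r a *\<^sub>R s a - r' (y - a) *\<^sub>R s a) / norm (y - a)
        \<le> norm (r y - r a - r' (y - a)) / norm (y - a) * norm (s y) + K * norm (s y - s a)"
      unfolding eventually_at_filter
    proof (intro always_eventually allI impI)
      fix y assume "y \<noteq> a"
      then have p: "norm (y - a) > 0" by simp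
      have "r y *\<^sub>R s y - r a *\<^sub>R s a - r' (y - a) *\<^sub>R s a
          = (r y - r a - r' (y - a)) *\<^sub>R s y + r' (y - a) *\<^sub>R (s y - s a)"
        using \<open>r a = 0\<close> by (simp add: algebra_simps)
      then have "norm (r y *\<^sub>R s y - r a *\<^sub>R s a - r' (y - a) *\<^sub>R s a)
          \<le> norm (r y - r a - r' (y - a)) * norm (s y) + norm (r' (y - a)) * norm (s y - s a)"
        by (metis norm_scaleR norm_triangle_ineq real_norm_def)
      also have "\<dots> \<le> norm (r y - r a - r' (y - a)) * norm (s y) + norm (y - a) * K * norm (s y - s a)"
        by (intro add_left_mono mult_right_mono K) auto
      finally show "norm (r y *\<^sub>R s y - r a *\<^sub>R s a - r' (y - a) *\<^sub>R s a) / norm (y - a)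
        \<le> norm (r y - r a - r' (y - a)) / norm (y - a) * norm (s y) + K * norm (s y - s a)"
        using p by (simp add: divide_simps) (simp add: algebra_simps)
    qed
  qed auto
qed

subsection \<open>Smoothness of local inverses\<close>

text \<open>Isolates the regularity question: \<open>g\<close> has the pointwise inverse
  \<open>B y\<close> of Df(g y) as its derivative, and nothing is yet assumed about how
  \<open>B y\<close> depends on \<open>y\<close>.\<close>

locale smooth_local_inverse =
  fixes f g :: "'a::euclidean_space \<Rightarrow> 'a" and W V :: "'a set" and B :: "'a \<Rightarrow> 'a \<Rightarrow> 'a"
  assumes open_W: "open W" and open_V: "open V" and smooth_f: "smooth_on W f"
    and g_into: "g ` V \<subseteq> W"
    and g_deriv: "y \<in> V \<Longrightarrow> (g has_derivative B y) (at y)"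
    and AB: "y \<in> V \<Longrightarrow> frechet_derivative f (at (g y)) (B y v) = v"
    and BA: "y \<in> V \<Longrightarrow> B y (frechet_derivative f (at (g y)) v) = v"
begin

definition A :: "'a \<Rightarrow> 'a \<Rightarrow> 'a" where "A y = frechet_derivative f (at (g y))"

lemma linear_A: "y \<in> V \<Longrightarrow> linear (A y)"
  unfolding A_def
proof (rule has_derivative_linear)
  assume "y \<in> V"
  then show "(f has_derivative frechet_derivative f (at (g y))) (at (g y))"
    using smooth_f g_into unfolding smooth_on_def
    by (intro Ck_on_SucD_has_derivative[where k = 0 and S = W]) blast+
qed

lemma linear_B: "y \<in> V \<Longrightarrow> linear (B y)"
  using g_deriv has_derivative_linear by blast

lemma g_continuous: "continuous_on V g"
  using g_deriv has_derivative_at_withinI has_derivative_continuous_on by blast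

lemma smooth_directional: "Ck_on k W (\<lambda>x. frechet_derivative f (at x) v)"
  using smooth_f unfolding smooth_on_def by (metis Ck_on.simps(2))

section \<open>Continuity and differentiability of the inverse operator\<close>

lemma A_has_derivative:
  assumes "y \<in> V"
  shows "((\<lambda>y. A y v) has_derivative
    (\<lambda>h. frechet_derivative (\<lambda>x. frechet_derivative f (at x) v) (at (g y)) (B y h))) (at y)"
  unfolding A_def
proof (rule has_derivative_compose[OF g_deriv[OF assms]])
  show "((\<lambda>x. frechet_derivative f (at x) v) has_derivative
      frechet_derivative (\<lambda>x. frechet_derivative f (at x) v) (at (g y))) (at (g y))"
    using smooth_directional[of "Suc 0"] g_into assms
    by (intro Ck_on_SucD_has_derivative[where S = W]) blast+
qed

text \<open>The injective \<open>A y0\<close> is bounded below by some \<open>c\<close>. Near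
  \<open>y0\<close> the operators \<open>A y\<close> and \<open>A y0\<close> differ by less than c/2
  in norm, so \<open>A y\<close> is bounded below by c/2 and its inverse \<open>B y\<close> is
  bounded by 2/c.\<close>

lemma B_eventually_bounded:
  assumes "y0 \<in> V"
  obtains K where "K > 0" "\<forall>\<^sub>F y in nhds y0. y \<in> V \<and> (\<forall>w. norm (B y w) \<le> K * norm w)"
proof -
  have "inj (A y0)" using BA[OF assms] unfolding A_def by (metis injI)
  then obtain c where c: "c > 0" "\<And>w. c * norm w \<le> norm (A y0 w)"
    using linear_inj_bounded_below_pos[OF linear_A[OF assms]] by blast
  \<comment> \<open>\<open>e y\<close> dominates the operator norm of \<open>A y - A y0\<close>, and
    it is continuous because it involves only finitely many fixed directions.\<close>
  define e where "e = (\<lambda>y. \<Sum>b\<in>Basis. norm (A y b - A y0 b))"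
  have "isCont e y0"
    unfolding e_def
    by (intro continuous_intros has_derivative_continuous[OF A_has_derivative[OF assms]])
  then have "(e \<longlongrightarrow> e y0) (nhds y0)" by (simp add: isCont_def tendsto_at_iff_tendsto_nhds)
  moreover have "e y0 < c/2" unfolding e_def using \<open>c > 0\<close> by simp
  ultimately have ev: "\<forall>\<^sub>F y in nhds y0. e y < c/2" by (rule order_tendstoD)
  have evV: "\<forall>\<^sub>F y in nhds y0. y \<in> V" using open_V assms eventually_nhds_in_open by blast
  show thesis
  proof
    show "2/c > 0" using \<open>c > 0\<close> by simp
    show "\<forall>\<^sub>F y in nhds y0. y \<in> V \<and> (\<forall>w. norm (B y w) \<le> 2/c * norm w)"
      using ev evV
    proof eventually_elim
      case (elim y)
      show ?case
      proof (intro conjI allI)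
        fix w
        define z where "z = B y w"
        have diff: "A y z - A y0 z = (\<Sum>b\<in>Basis. (z \<bullet> b) *\<^sub>R (A y b - A y0 b))"
          unfolding scaleR_diff_right sum_subtractf linear_eq_sum_Basis[OF linear_A[OF elim(2)], symmetric]
            linear_eq_sum_Basis[OF linear_A[OF assms], symmetric] ..
        have "norm (A y z - A y0 z) \<le> (\<Sum>b\<in>Basis. norm z * norm (A y b - A y0 b))"
          unfolding diff by (rule sum_norm_le) (auto intro!: mult_right_mono Basis_le_norm)
        also have "\<dots> = norm z * e y" unfolding e_def by (rule sum_distrib_left[symmetric])
        also have "\<dots> \<le> norm z * (c/2)" using elim(1) by (intro mult_left_mono) auto
        finally have "norm (A y z - A y0 z) \<le> norm z * (c/2)" .
        moreover have "norm (A y0 z) \<le> norm (A y z) + norm (A y z - A y0 z)"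
          by (metis add.commute norm_minus_commute norm_triangle_sub)
        moreover have "c * norm z \<le> norm (A y0 z)" by (rule c)
        ultimately have "c/2 * norm z \<le> norm (A y z)" by (simp add: algebra_simps)
        moreover have "A y z = w" using AB[OF elim(2)] by (simp add: A_def z_def)
        ultimately show "norm (B y w) \<le> 2/c * norm w"
          using \<open>c > 0\<close> by (simp add: z_def field_simps)
      qed (use elim in auto)
    qed
  qed
qed

text \<open>The resolvent identity B y - B y0 = B y (A y0 - A y) B y0, with
  \<open>A y0 (B y0 v)\<close> simplified to \<open>v\<close>.\<close>

lemma B_resolvent:
  assumes "y \<in> V" "y0 \<in> V"
  shows "B y v = B y0 v + B y (v - A y (B y0 v))"
  using BA[OF assms(1), of "B y0 v"] linear_B[OF assms(1)] unfolding A_def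
  by (simp add: linear_diff)

text \<open>By the resolvent identity the increment is \<open>B y\<close> applied to a residue that
  tends to 0 at \<open>y0\<close>, and the operators \<open>B y\<close> are uniformly bounded
  there.\<close>

lemma B_isCont:
  assumes "y0 \<in> V"
  shows "isCont (\<lambda>y. B y v) y0"
proof -
  obtain K where K: "K > 0" "\<forall>\<^sub>F y in nhds y0. y \<in> V \<and> (\<forall>w. norm (B y w) \<le> K * norm w)"
    using B_eventually_bounded[OF assms] .
  have "isCont (\<lambda>y. K * norm (v - A y (B y0 v))) y0"
    by (intro continuous_intros has_derivative_continuous[OF A_has_derivative[OF assms]])
  then have "((\<lambda>y. K * norm (v - A y (B y0 v))) \<longlongrightarrow> 0) (at y0)"
    using AB[OF assms, of v] by (simp add: isCont_def A_def)
  moreover have "\<forall>\<^sub>F y in at y0. norm (B y v - B y0 v) \<le> K * norm (v - A y (B y0 v))"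
    using eventually_nhds_conv_at[of _ y0, THEN iffD1, OF K(2), THEN conjunct1]
    by eventually_elim (metis B_resolvent add_diff_cancel_left' assms)
  ultimately have "((\<lambda>y. B y v - B y0 v) \<longlongrightarrow> 0) (at y0)"
    by (rule Lim_null_comparison[rotated])
  then show ?thesis using LIM_zero_iff isCont_def by blast
qed

text \<open>The resolvent identity, expanded in \<open>Basis\<close>, writes \<open>B y v\<close> as
  a constant plus a sum of products of a differentiable scalar vanishing at \<open>y0\<close> with
  some \<open>B y c\<close>. \<open>has_derivative_scaleR_vanishing\<close> then needs only the
  continuity of \<open>B y c\<close>, so there is no circularity.\<close>

lemma B_has_derivative:
  assumes "y0 \<in> V"
  shows "((\<lambda>y. B y v) has_derivative (\<lambda>h. - (\<Sum>c\<in>Basis.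
    (frechet_derivative (\<lambda>x. frechet_derivative f (at x) (B y0 v)) (at (g y0)) (B y0 h) \<bullet> c) *\<^sub>R B y0 c)))
    (at y0)"
proof (rule has_derivative_transform_within_open[OF _ open_V assms])
  let ?D = "\<lambda>h. frechet_derivative (\<lambda>x. frechet_derivative f (at x) (B y0 v)) (at (g y0)) (B y0 h)"
  define r where "r = (\<lambda>y. v - A y (B y0 v))"
  have r: "(r has_derivative (\<lambda>h. 0 - ?D h)) (at y0)"
    unfolding r_def by (rule has_derivative_diff[OF has_derivative_const A_has_derivative[OF assms]])
  have r0: "r y0 = 0" using AB[OF assms] by (simp add: r_def A_def)
  have "((\<lambda>y. B y0 v + (\<Sum>c\<in>Basis. (r y \<bullet> c) *\<^sub>R B y c)) has_derivative
      (\<lambda>h. 0 + (\<Sum>c\<in>Basis. ((0 - ?D h) \<bullet> c) *\<^sub>R B y0 c))) (at y0)"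
    by (intro has_derivative_add has_derivative_const has_derivative_sum has_derivative_scaleR_vanishing
        has_derivative_inner_left r B_isCont assms) (simp add: r0)
  then show "((\<lambda>y. B y0 v + (\<Sum>c\<in>Basis. (r y \<bullet> c) *\<^sub>R B y c)) has_derivative
      (\<lambda>h. - (\<Sum>c\<in>Basis. (?D h \<bullet> c) *\<^sub>R B y0 c))) (at y0)"
    by (simp add: sum_negf)
  fix y assume "y \<in> V"
  have "B y0 v + (\<Sum>c\<in>Basis. (r y \<bullet> c) *\<^sub>R B y c) = B y0 v + B y (r y)"
    unfolding linear_eq_sum_Basis[OF linear_B[OF \<open>y \<in> V\<close>], symmetric] ..
  also have "\<dots> = B y v" unfolding r_def by (rule B_resolvent[OF \<open>y \<in> V\<close> assms, symmetric])
  finally show "B y0 v + (\<Sum>c\<in>Basis. (r y \<bullet> c) *\<^sub>R B y c) = B y v" .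
qed

text \<open>In the derivative of \<open>B\<close> both directions of the second derivative of
  \<open>f\<close> move with \<open>y\<close>. Bilinear expansion shifts this dependence into scalar
  coefficients, leaving second derivatives in fixed basis directions.\<close>

lemma second_derivative_expand:
  assumes "y \<in> V"
  shows "frechet_derivative (\<lambda>x. frechet_derivative f (at x) v) (at (g y)) w
    = (\<Sum>a\<in>Basis. \<Sum>b\<in>Basis. ((v \<bullet> a) * (w \<bullet> b)) *\<^sub>R
        frechet_derivative (\<lambda>x. frechet_derivative f (at x) a) (at (g y)) b)"
proof -
  let ?D = "\<lambda>v. frechet_derivative (\<lambda>x. frechet_derivative f (at x) v) (at (g y))"
  have gy: "g y \<in> W" using assms g_into by auto
  have D: "((\<lambda>x. frechet_derivative f (at x) v) has_derivative ?D v) (at (g y))" for v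
    using smooth_directional[of "Suc 0"] gy by (intro Ck_on_SucD_has_derivative[where S = W]) blast+
  have lin: "linear (frechet_derivative f (at x))" if "x \<in> W" for x
    using smooth_f that unfolding smooth_on_def
    by (intro has_derivative_linear[OF Ck_on_SucD_has_derivative[where k = 0 and S = W]]) blast+
  have "((\<lambda>x. frechet_derivative f (at x) v) has_derivative (\<lambda>w. \<Sum>a\<in>Basis. (v \<bullet> a) *\<^sub>R ?D a w)) (at (g y))"
  proof (rule has_derivative_transform_within_open[OF _ open_W gy])
    show "((\<lambda>x. \<Sum>a\<in>Basis. (v \<bullet> a) *\<^sub>R frechet_derivative f (at x) a) has_derivative
        (\<lambda>w. \<Sum>a\<in>Basis. (v \<bullet> a) *\<^sub>R ?D a w)) (at (g y))"
      by (intro has_derivative_sum has_derivative_scaleR_right D)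
    show "(\<Sum>a\<in>Basis. (v \<bullet> a) *\<^sub>R frechet_derivative f (at x) a) = frechet_derivative f (at x) v"
      if "x \<in> W" for x
      by (rule linear_eq_sum_Basis[OF lin[OF that], symmetric])
  qed
  then have "?D v w = (\<Sum>a\<in>Basis. (v \<bullet> a) *\<^sub>R ?D a w)"
    by (rule fun_cong[OF has_derivative_unique[OF D]])
  also have "\<dots> = (\<Sum>a\<in>Basis. (v \<bullet> a) *\<^sub>R (\<Sum>b\<in>Basis. (w \<bullet> b) *\<^sub>R ?D a b))"
    unfolding linear_eq_sum_Basis[OF has_derivative_linear[OF D], symmetric] ..
  finally show ?thesis by (simp add: scaleR_sum_right)
qed

text \<open>The induction must be simultaneous: the derivative of \<open>g\<close> is
  \<open>B\<close>, and that of \<open>B\<close> is a polynomial expression in \<open>B\<close> and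
  second derivatives of \<open>f\<close> composed with \<open>g\<close>.\<close>

lemma Ck_on_inverse: "Ck_on k V g \<and> (\<forall>v. Ck_on k V (\<lambda>y. B y v))"
proof (induction k)
  case 0
  then show ?case
    using g_continuous B_isCont by (auto intro: continuous_at_imp_continuous_on)
next
  case (Suc k)
  have "Ck_on (Suc k) V g"
    by (rule Ck_on_SucI[OF open_V g_deriv]) (use Suc in auto)
  moreover have "Ck_on (Suc k) V (\<lambda>y. B y v)" for v
  proof (rule Ck_on_SucI[OF open_V B_has_derivative])
    fix h
    have D2: "Ck_on k V (\<lambda>y. frechet_derivative (\<lambda>x. frechet_derivative f (at x) a) (at (g y)) b)" for a b
    proof (rule Ck_on_compose[OF open_V open_W _ _ g_into])
      show "Ck_on k W (\<lambda>x. frechet_derivative (\<lambda>x. frechet_derivative f (at x) a) (at x) b)"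
        using smooth_directional[of "Suc k"] by simp
    qed (use Suc in auto)
    have comp: "Ck_on k V (\<lambda>y. B y v \<bullet> b)" for v b
      using Suc by (intro Ck_on_bounded_linear_comp[OF open_V bounded_linear_inner_left]) auto
    have "Ck_on k V (\<lambda>y. - (\<Sum>c\<in>Basis. ((\<Sum>a\<in>Basis. \<Sum>b\<in>Basis. ((B y v \<bullet> a) * (B y h \<bullet> b)) *\<^sub>R
        frechet_derivative (\<lambda>x. frechet_derivative f (at x) a) (at (g y)) b) \<bullet> c) *\<^sub>R B y c))"
      using Suc
      by (intro Ck_on_bounded_linear_comp[OF open_V bounded_linear_minus[OF bounded_linear_ident]]
          Ck_on_bounded_linear_comp[OF open_V bounded_linear_inner_left]
          Ck_on_sum Ck_on_scaleR bounded_bilinear.Ck_on[OF bounded_bilinear_mult] comp D2 open_V) auto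
    then show "Ck_on k V (\<lambda>y. - (\<Sum>c\<in>Basis.
        (frechet_derivative (\<lambda>x. frechet_derivative f (at x) (B y v)) (at (g y)) (B y h) \<bullet> c) *\<^sub>R B y c))"
      by (rule Ck_on_cong[OF open_V, rotated]) (subst second_derivative_expand, simp_all)
  qed
  ultimately show ?case by blast
qed

end

text \<open>The C^1 inverse function theorem supplies the local inverse and its derivative;
  \<open>smooth_local_inverse\<close> then raises its regularity.\<close>

theorem smooth_inverse_function_theorem:
  fixes f :: "'a::euclidean_space \<Rightarrow> 'a"
  assumes "open W" "smooth_on W f" "p \<in> W" "inj (frechet_derivative f (at p))"
  obtains U V g where "open U" "U \<subseteq> W" "p \<in> U" "open V" "homeomorphism U V f g" "smooth_on V g"
    "(g has_derivative inv (frechet_derivative f (at p))) (at (f p))"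
proof -
  define f' where "f' x = Blinfun (frechet_derivative f (at x))" for x
  have D: "(f has_derivative frechet_derivative f (at x)) (at x)" if "x \<in> W" for x
    using assms(2) that unfolding smooth_on_def
    by (intro Ck_on_SucD_has_derivative[where k = 0 and S = W]) blast+
  have f': "blinfun_apply (f' x) = frechet_derivative f (at x)" if "x \<in> W" for x
    unfolding f'_def using D[OF that] bounded_linear_Blinfun_apply has_derivative_bounded_linear by blast
  have derf: "(f has_derivative blinfun_apply (f' x)) (at x)" if "x \<in> W" for x
    using D f' that by simp
  \<comment> \<open>Continuity in operator norm follows from continuity in each direction because
    the domain is finite-dimensional.\<close>
  have contf: "continuous_on W f'"
  proof (rule continuous_on_blinfun_componentwise)
    fix i :: 'a
    have "Ck_on (Suc 0) W f" using assms(2) smooth_on_def by blast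
    then have "continuous_on W (\<lambda>x. frechet_derivative f (at x) i)" by simp
    then show "continuous_on W (\<lambda>x. blinfun_apply (f' x) i)"
      by (rule continuous_on_eq) (simp add: f')
  qed
  have lin: "linear (frechet_derivative f (at p))" using D assms(3) has_derivative_linear by blast
  \<comment> \<open>The C^1 theorem takes invertibility at \<open>p\<close> as a bounded linear left
    inverse; injectivity provides one.\<close>
  obtain h where h: "linear h" "h \<circ> frechet_derivative f (at p) = id"
    using linear_injective_left_inverse[OF lin assms(4)] by blast
  have "Blinfun h o\<^sub>L f' p = id_blinfun"
    using h f'[OF assms(3)]
    by (intro blinfun_eqI) (simp add: linear_conv_bounded_linear bounded_linear_Blinfun_apply o_def fun_eq_iff)
  from inverse_function_theorem[OF assms(1) derf contf assms(3) this]
  obtain U V g g' where UV: "open U" "U \<subseteq> W" "p \<in> U" "open V" "f p \<in> V" "homeomorphism U V f g"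
    and g: "\<And>y. y \<in> V \<Longrightarrow> (g has_derivative g' y) (at y)"
    and g': "\<And>y. y \<in> V \<Longrightarrow> g' y = inv (blinfun_apply (f' (g y)))"
    and bij: "\<And>y. y \<in> V \<Longrightarrow> bij (blinfun_apply (f' (g y)))" by metis
  have gW: "g y \<in> W" if "y \<in> V" for y
    using UV that by (metis homeomorphism_image2 imageI subsetD)
  interpret smooth_local_inverse f g W V g'
  proof
    show "g ` V \<subseteq> W" using gW by auto
    show "frechet_derivative f (at (g y)) (g' y v) = v" "g' y (frechet_derivative f (at (g y)) v) = v"
      if "y \<in> V" for y v
      using g'[OF that] bij[OF that] f'[OF gW[OF that]]
      by (simp_all add: bij_is_inj bij_is_surj surj_f_inv_f)
  qed (use UV assms g in auto)
  have "smooth_on V g" using Ck_on_inverse smooth_on_def by blast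
  moreover have "g (f p) = p" using UV by (simp add: homeomorphism_apply1)
  then have "(g has_derivative inv (frechet_derivative f (at p))) (at (f p))"
    using g[OF UV(5)] g'[OF UV(5)] f'[OF assms(3)] by simp
  ultimately show thesis using that UV by blast
qed

subsection \<open>The zero set and its tangent spaces\<close>

lemma vec_complex_expand:
  fixes v :: "complex ^ 'n"
  shows "v = (\<Sum>n\<in>UNIV. Re (v $ n) *\<^sub>R axis n 1 + Im (v $ n) *\<^sub>R axis n \<i>)"
  by (simp add: vec_eq_iff axis_def complex_eq_iff if_distrib[of Re] if_distrib[of Im]
      if_distrib[of "(*) _"] cong: if_cong)

lemma has_derivative_imp_deriv_line:
  fixes f :: "'a::real_normed_vector \<Rightarrow> real"
  assumes "(f has_derivative D) (at x)"
  shows "deriv (\<lambda>t. f (x + t *\<^sub>R a)) 0 = D a"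
proof (rule DERIV_imp_deriv)
  have "((\<lambda>t. x + t *\<^sub>R a) has_derivative (\<lambda>t. t *\<^sub>R a)) (at 0)"
    by (auto intro!: derivative_eq_intros)
  then have "((\<lambda>t. f (x + t *\<^sub>R a)) has_derivative (\<lambda>t. D (t *\<^sub>R a))) (at 0)"
    by (rule has_derivative_compose) (use assms in simp)
  moreover have "(\<lambda>t. D (t *\<^sub>R a)) = (*) (D a)"
    using linear_scale[OF has_derivative_linear[OF assms]] by (auto simp: mult.commute)
  ultimately show "((\<lambda>t. f (x + t *\<^sub>R a)) has_field_derivative D a) (at 0)"
    by (simp add: has_field_derivative_def)
qed

text \<open>For real-valued \<open>f\<close> the du and d(bar u) parts of df are conjugate, so df is
  twice the real part of the first. This expresses the real differential through \<open>M\<close>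
  alone.\<close>

lemma has_derivative_wirtinger:
  fixes f :: "complex ^ 'n::finite \<Rightarrow> real"
  assumes "(f has_derivative D) (at x)"
  shows "D v = 2 * Re (\<Sum>n\<in>UNIV. wirtinger n f x * v $ n)"
proof -
  have lin: "linear D" using assms has_derivative_linear by blast
  have p: "partial_re n f x = D (axis n 1)" "partial_im n f x = D (axis n \<i>)" for n
    unfolding partial_re_def partial_im_def using has_derivative_imp_deriv_line[OF assms] by auto
  have "D v = (\<Sum>n\<in>UNIV. Re (v $ n) * partial_re n f x + Im (v $ n) * partial_im n f x)"
    by (subst vec_complex_expand[of v]) (simp add: linear_sum[OF lin] linear_add[OF lin] linear_scale[OF lin] p)
  also have "\<dots> = 2 * Re (\<Sum>n\<in>UNIV. wirtinger n f x * v $ n)"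
    by (simp add: wirtinger_def sum_distrib_left algebra_simps)
  finally show ?thesis .
qed

text \<open>The real form i R^d of C^d. It is both the linear model of the zero set in a chart and
  the image under \<open>M\<close> of each tangent space.\<close>

definition imaginary_vectors :: "(complex ^ 'n) set" where
  "imaginary_vectors = {v. \<forall>m. Re (v $ m) = 0}"

lemma subspace_imaginary_vectors: "subspace imaginary_vectors"
  by (auto simp: subspace_def imaginary_vectors_def)

lemma dim_imaginary_vectors: "dim (imaginary_vectors :: (complex ^ 'n::finite) set) = CARD('n)"
proof -
  define h :: "real ^ 'n \<Rightarrow> complex ^ 'n" where "h = (\<lambda>y. \<chi> m. Complex 0 (y $ m))"
  have "linear h" by (rule linearI) (auto simp: h_def vec_eq_iff complex_eq_iff)
  moreover have "inj h" by (auto simp: inj_def h_def vec_eq_iff)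
  ultimately have "dim (range h) = dim (UNIV :: (real ^ 'n) set)"
    by (intro dim_image_eq) (auto intro: inj_on_subset)
  moreover have "range h = imaginary_vectors"
  proof
    show "imaginary_vectors \<subseteq> range h"
    proof
      fix v :: "complex ^ 'n" assume "v \<in> imaginary_vectors"
      then have "v = h (\<chi> m. Im (v $ m))" by (simp add: h_def vec_eq_iff complex_eq_iff imaginary_vectors_def)
      then show "v \<in> range h" by blast
    qed
  qed (auto simp: h_def imaginary_vectors_def)
  ultimately show ?thesis by simp
qed

section \<open>Straightening charts, embeddedness and tangent spaces\<close>

locale smooth_family =
  fixes f :: "'n::finite \<Rightarrow> complex ^ 'n \<Rightarrow> real"
  assumes smooth: "smooth_on UNIV (f m)"
begin

definition zero_set :: "(complex ^ 'n) set" where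
  "zero_set = {x. \<forall>m. f m x = 0}"

text \<open>The defining functions are completed to 2d real coordinates by the linear functions Im
  (M(p) x). Points of the zero set are then exactly those sent to \<open>imaginary_vectors\<close>,
  and the derivative at \<open>p\<close> is M(p) up to doubling real parts, hence injective when
  M(p) is invertible.\<close>

definition chart :: "complex ^ 'n \<Rightarrow> complex ^ 'n \<Rightarrow> complex ^ 'n" where
  "chart p x = (\<chi> m. Complex (f m x) (Im ((M_mat f p *v x) $ m)))"

lemma f_has_derivative: "(f m has_derivative (\<lambda>v. 2 * Re ((M_mat f x *v v) $ m))) (at x)"
proof -
  have D: "(f m has_derivative frechet_derivative (f m) (at x)) (at x)"
    using smooth[of m] unfolding smooth_on_def
    by (intro Ck_on_SucD_has_derivative[where k = 0 and S = UNIV]) blast+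
  moreover have "frechet_derivative (f m) (at x) = (\<lambda>v. 2 * Re ((M_mat f x *v v) $ m))"
    using has_derivative_wirtinger[OF D] by (simp add: fun_eq_iff M_mat_def matrix_vector_mult_def)
  ultimately show ?thesis by simp
qed

text \<open>Splits the chart into scalar functions times fixed vectors and one real-linear map, the
  form to which the differentiation and smoothness rules apply.\<close>

lemma chart_altdef:
  "chart p x = (\<Sum>m\<in>UNIV. f m x *\<^sub>R axis m 1) + (\<chi> m. Complex 0 (Im ((M_mat f p *v x) $ m)))"
  by (simp add: chart_def vec_eq_iff axis_def complex_eq_iff if_distrib[of Re] if_distrib[of Im]
      if_distrib[of "(*) _"] cong: if_cong)

lemma bounded_linear_chart_Im: "bounded_linear (\<lambda>x. \<chi> m. Complex 0 (Im ((M_mat f p *v x) $ m)))"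
  unfolding linear_conv_bounded_linear[symmetric]
proof (rule linearI)
  have "M_mat f p *v (r *\<^sub>R x) = r *\<^sub>R (M_mat f p *v x)" for r x
    by (simp add: vec_eq_iff matrix_vector_mult_def scaleR_sum_right)
  then show "(\<chi> m. Complex 0 (Im ((M_mat f p *v (r *\<^sub>R x)) $ m))) = r *\<^sub>R (\<chi> m. Complex 0 (Im ((M_mat f p *v x) $ m)))"
    for r x by (simp add: vec_eq_iff complex_eq_iff)
qed (simp add: vec_eq_iff complex_eq_iff matrix_vector_right_distrib)

lemma smooth_on_chart: "smooth_on UNIV (chart p)"
  unfolding smooth_on_def chart_altdef[abs_def]
proof
  fix k
  show "Ck_on k UNIV (\<lambda>x. (\<Sum>m\<in>UNIV. f m x *\<^sub>R axis m 1) + (\<chi> m. Complex 0 (Im ((M_mat f p *v x) $ m))))"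
    using smooth unfolding smooth_on_def
    by (intro Ck_on_add Ck_on_sum Ck_on_scaleR Ck_on_const Ck_on_id
        Ck_on_bounded_linear_comp[OF _ bounded_linear_chart_Im]) auto
qed

definition chart_deriv :: "complex ^ 'n \<Rightarrow> complex ^ 'n \<Rightarrow> complex ^ 'n" where
  "chart_deriv p v = (\<chi> m. Complex (2 * Re ((M_mat f p *v v) $ m)) (Im ((M_mat f p *v v) $ m)))"

lemma chart_has_derivative: "(chart p has_derivative chart_deriv p) (at p)"
proof -
  have "chart_deriv p = (\<lambda>v. (\<Sum>m\<in>UNIV. (2 * Re ((M_mat f p *v v) $ m)) *\<^sub>R axis m 1)
      + (\<chi> m. Complex 0 (Im ((M_mat f p *v v) $ m))))"
    by (simp add: chart_deriv_def fun_eq_iff vec_eq_iff axis_def complex_eq_iff if_distrib[of Re]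
        if_distrib[of Im] if_distrib[of "(*) _"] cong: if_cong)
  then show ?thesis
    unfolding chart_altdef[abs_def]
    by (simp only:) (intro has_derivative_add has_derivative_sum has_derivative_scaleR_left
        f_has_derivative bounded_linear_imp_has_derivative bounded_linear_chart_Im)
qed

lemma inj_chart_deriv:
  assumes "invertible (M_mat f p)"
  shows "inj (chart_deriv p)"
proof (rule injI)
  fix v w assume "chart_deriv p v = chart_deriv p w"
  then have "M_mat f p *v v = M_mat f p *v w"
    by (simp add: chart_deriv_def vec_eq_iff complex_eq_iff)
  then show "v = w" using assms inj_matrix_vector_mult injD by metis
qed

lemma chart_imaginary_iff: "chart p x \<in> imaginary_vectors \<longleftrightarrow> x \<in> zero_set"
  by (simp add: chart_def imaginary_vectors_def zero_set_def)

lemma chart_local_inverse: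
  assumes "invertible (M_mat f p)"
  obtains U V g where "open U" "p \<in> U" "open V" "homeomorphism U V (chart p) g" "smooth_on V g"
    "(g has_derivative inv (chart_deriv p)) (at (chart p p))"
proof -
  have "frechet_derivative (chart p) (at p) = chart_deriv p"
    using frechet_derivative_at[OF chart_has_derivative] by simp
  then show thesis
    using smooth_inverse_function_theorem[OF open_UNIV smooth_on_chart[of p] UNIV_I]
      inj_chart_deriv[OF assms] that by metis
qed

text \<open>The chart at \<open>p\<close> itself is the flattening map, with
  \<open>imaginary_vectors\<close> as the model subspace of real dimension d.\<close>

lemma embedded_submanifold_zero_set:
  assumes "\<And>x. x \<in> zero_set \<Longrightarrow> invertible (M_mat f x)"
  shows "embedded_submanifold CARD('n) zero_set"
  unfolding embedded_submanifold_def
proof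
  fix p assume "p \<in> zero_set"
  then obtain U V g where UV: "open U" "p \<in> U" "open V" "homeomorphism U V (chart p) g" "smooth_on V g"
    using chart_local_inverse assms by metis
  have "smooth_on U (chart p)"
    using smooth_on_chart Ck_on_subset[OF _ subset_UNIV] unfolding smooth_on_def by blast
  moreover have "chart p ` (zero_set \<inter> U) = V \<inter> imaginary_vectors"
  proof
    show "chart p ` (zero_set \<inter> U) \<subseteq> V \<inter> imaginary_vectors"
      using homeomorphism_image1[OF UV(4)] chart_imaginary_iff by auto
    show "V \<inter> imaginary_vectors \<subseteq> chart p ` (zero_set \<inter> U)"
    proof
      fix y assume y: "y \<in> V \<inter> imaginary_vectors"
      then have "chart p (g y) = y" "g y \<in> U"
        using UV(4) homeomorphism_apply2 homeomorphism_image2 by fastforce+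
      then show "y \<in> chart p ` (zero_set \<inter> U)" using chart_imaginary_iff y by (metis IntD2 IntI imageI)
    qed
  qed
  ultimately show "\<exists>U V L (\<phi> :: complex ^ 'n \<Rightarrow> complex ^ 'n) \<psi>.
      open U \<and> p \<in> U \<and> open V \<and> subspace L \<and> dim L = CARD('n) \<and>
      homeomorphism U V \<phi> \<psi> \<and> smooth_on U \<phi> \<and> smooth_on V \<psi> \<and> \<phi> ` (zero_set \<inter> U) = V \<inter> L"
    using UV subspace_imaginary_vectors dim_imaginary_vectors by blast
qed

text \<open>Differentiating \<open>f m\<close> along a curve in the zero set gives one inclusion.
  For the other, a straight line in \<open>imaginary_vectors\<close> is pulled back through the
  local inverse of the chart.\<close>

lemma tangent_space_zero_set:
  assumes "p \<in> zero_set" "invertible (M_mat f p)"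
  shows "tangent_space zero_set p = {v. M_mat f p *v v \<in> imaginary_vectors}"
proof (intro equalityI subsetI)
  fix v assume "v \<in> tangent_space zero_set p"
  then obtain \<gamma> \<epsilon> where \<gamma>: "\<epsilon> > (0::real)" "\<gamma> ` {-\<epsilon><..<\<epsilon>} \<subseteq> zero_set" "\<gamma> 0 = p"
    "(\<gamma> has_vector_derivative v) (at 0)"
    unfolding tangent_space_def by blast
  have "Re ((M_mat f p *v v) $ m) = 0" for m
  proof -
    have "((\<lambda>t. f m (\<gamma> t)) has_derivative (\<lambda>t. 2 * Re ((M_mat f p *v (t *\<^sub>R v)) $ m))) (at 0)"
      using \<gamma>(3,4) f_has_derivative[of m p] unfolding has_vector_derivative_def
      by (intro has_derivative_compose[of \<gamma> _ 0 UNIV "f m"]) auto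
    moreover have "((\<lambda>t. f m (\<gamma> t)) has_derivative (\<lambda>t. 0)) (at 0)"
    proof (rule has_derivative_transform_within_open[OF has_derivative_const])
      show "open {-\<epsilon><..<\<epsilon>}" "0 \<in> {-\<epsilon><..<\<epsilon>}" using \<gamma>(1) by auto
      fix t assume "t \<in> {-\<epsilon><..<\<epsilon>}"
      then have "\<gamma> t \<in> zero_set" using \<gamma>(2) by blast
      then show "0 = f m (\<gamma> t)" by (simp add: zero_set_def)
    qed
    ultimately have "(\<lambda>t::real. 2 * Re ((M_mat f p *v (t *\<^sub>R v)) $ m)) = (\<lambda>t. 0)"
      by (rule has_derivative_unique)
    \<comment> \<open>Evaluate the equality of linear maps at t = 1.\<close>
    then show ?thesis by (metis mult_eq_0_iff scaleR_one zero_neq_numeral)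
  qed
  then show "v \<in> {v. M_mat f p *v v \<in> imaginary_vectors}" by (simp add: imaginary_vectors_def)
next
  fix v assume "v \<in> {v. M_mat f p *v v \<in> imaginary_vectors}"
  then have w: "chart_deriv p v \<in> imaginary_vectors" by (simp add: imaginary_vectors_def chart_deriv_def)
  define w where "w = chart_deriv p v"
  obtain U V g where UV: "open U" "p \<in> U" "open V" "homeomorphism U V (chart p) g" "smooth_on V g"
    and g: "(g has_derivative inv (chart_deriv p)) (at (chart p p))"
    using chart_local_inverse assms by metis
  \<comment> \<open>The line leaves the image of \<open>p\<close> with velocity \<open>w\<close> and
    stays in \<open>imaginary_vectors\<close>; \<open>g\<close> maps it to a curve in the zero set
    with initial velocity \<open>v\<close>.\<close>
  define l where "l = (\<lambda>t::real. chart p p + t *\<^sub>R w)"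
  have "open (l -` V)"
    unfolding l_def by (intro open_vimage UV continuous_intros)
  moreover have "0 \<in> l -` V" using UV homeomorphism_image1 by (fastforce simp: l_def)
  ultimately obtain \<epsilon> where \<epsilon>: "\<epsilon> > 0" "ball 0 \<epsilon> \<subseteq> l -` V"
    using open_contains_ball by blast
  then have lV: "l ` {-\<epsilon><..<\<epsilon>} \<subseteq> V" by (auto simp: subset_iff)
  have "smooth_on {-\<epsilon><..<\<epsilon>} (\<lambda>t. g (l t))"
    unfolding smooth_on_def
  proof
    fix k
    have "Ck_on k {-\<epsilon><..<\<epsilon>} l"
      unfolding l_def by (intro Ck_on_add Ck_on_scaleR Ck_on_const Ck_on_id) auto
    then show "Ck_on k {-\<epsilon><..<\<epsilon>} (\<lambda>t. g (l t))"
      using Ck_on_compose[OF open_greaterThanLessThan UV(3) _ _ lV] UV(5) smooth_on_def by blast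
  qed
  moreover have "(\<lambda>t. g (l t)) ` {-\<epsilon><..<\<epsilon>} \<subseteq> zero_set"
  proof
    fix x assume "x \<in> (\<lambda>t. g (l t)) ` {-\<epsilon><..<\<epsilon>}"
    then obtain t where t: "t \<in> {-\<epsilon><..<\<epsilon>}" "x = g (l t)" by blast
    have "l t \<in> V" using lV t(1) by blast
    then have "chart p x = l t" using homeomorphism_apply2[OF UV(4)] t(2) by simp
    moreover have "l t \<in> imaginary_vectors"
      unfolding l_def w_def
      by (intro subspace_add subspace_scale subspace_imaginary_vectors w) (simp add: chart_imaginary_iff assms(1))
    ultimately show "x \<in> zero_set" using chart_imaginary_iff by metis
  qed
  moreover have "g (l 0) = p" using homeomorphism_apply1[OF UV(4,2)] by (simp add: l_def)
  moreover have "((\<lambda>t. g (l t)) has_vector_derivative v) (at 0)"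
  proof -
    have "(l has_derivative (\<lambda>t. t *\<^sub>R w)) (at 0)"
      unfolding l_def by (auto intro!: derivative_eq_intros)
    then have "((\<lambda>t. g (l t)) has_derivative (\<lambda>t. inv (chart_deriv p) (t *\<^sub>R w))) (at 0)"
      by (rule has_derivative_compose) (use g in \<open>simp add: l_def\<close>)
    moreover have "inv (chart_deriv p) (t *\<^sub>R w) = t *\<^sub>R v" for t
      by (simp add: w_def inv_f_f[OF inj_chart_deriv[OF assms(2)]] linear_scale[OF has_derivative_linear[OF g]])
    ultimately show ?thesis by (simp add: has_vector_derivative_def)
  qed
  ultimately show "v \<in> tangent_space zero_set p"
    unfolding tangent_space_def using \<epsilon>(1) by blast
qed

end

subsection \<open>Linear algebra of the two forms\<close>

definition cnj_mat :: "complex ^ 'n ^ 'm \<Rightarrow> complex ^ 'n ^ 'm" where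
  "cnj_mat A = (\<chi> i j. cnj (A $ i $ j))"

lemma cnj_mat_mult: "cnj_mat (A ** B) = cnj_mat A ** cnj_mat B"
  by (simp add: cnj_mat_def matrix_matrix_mult_def vec_eq_iff)

lemma cnj_mat_one: "cnj_mat (mat 1) = mat 1"
  by (simp add: cnj_mat_def mat_def vec_eq_iff)

lemma det_cnj_mat: "det (cnj_mat A) = cnj (det A)"
  by (simp add: det_def cnj_mat_def)

lemma cnj_mat_eq_iff: "cnj_mat A = A \<longleftrightarrow> (\<forall>i j. Im (A $ i $ j) = 0)"
  by (simp add: cnj_mat_def vec_eq_iff complex_eq_iff)

text \<open>Conjugating A B = 1 with \<open>A\<close> real shows that the conjugate of
  \<open>B\<close> is also a right inverse of \<open>A\<close>, so it equals
  \<open>B\<close>.\<close>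

lemma cnj_mat_inverse:
  fixes A B :: "complex ^ 'n ^ 'n"
  assumes "A ** B = mat 1" "cnj_mat A = A"
  shows "cnj_mat B = B"
proof -
  have "A ** cnj_mat B = mat 1" by (metis assms cnj_mat_mult cnj_mat_one)
  moreover have "B ** A = mat 1" using assms(1) matrix_left_right_inverse by blast
  ultimately show ?thesis by (metis matrix_mul_assoc matrix_mul_lid matrix_mul_rid)
qed

lemma det_of_real: "det (\<chi> i j. complex_of_real (A i j)) = complex_of_real (det (\<chi> i j. A i j))"
  by (simp add: det_def)

section \<open>Vanishing of omega and the reality of a Gram matrix\<close>

lemma omega_eq: "omega v w = complex_of_real (Im (\<Sum>n\<in>UNIV. v $ n * cnj (w $ n)))"
proof -
  \<comment> \<open>This is z - conj z = 2 i Im z for z = v_n conj (w_n); the factor 2 i cancels the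
    prefactor of \<open>omega\<close>.\<close>
  have "wedge2 (du n) (du_bar n) v w = 2 * \<i> * complex_of_real (Im (v $ n * cnj (w $ n)))" for n
    by (simp add: wedge2_def du_def du_bar_def complex_eq_iff)
  then show ?thesis by (simp add: omega_def flip: sum_distrib_left)
qed

text \<open>The Hermitian product in the coordinates given by \<open>P\<close>: its Gram matrix is
  P^T conj P.\<close>

lemma hermitian_product_mult:
  fixes P :: "complex ^ 'n ^ 'n"
  shows "(\<Sum>n\<in>UNIV. (P *v a) $ n * cnj ((P *v b) $ n))
    = (\<Sum>i\<in>UNIV. \<Sum>j\<in>UNIV. a $ i * cnj (b $ j) * (transpose P ** cnj_mat P) $ i $ j)"
proof -
  have "(\<Sum>n\<in>UNIV. (P *v a) $ n * cnj ((P *v b) $ n))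
    = (\<Sum>n\<in>UNIV. \<Sum>i\<in>UNIV. \<Sum>j\<in>UNIV. a $ i * cnj (b $ j) * (P $ n $ i * cnj (P $ n $ j)))"
    by (simp add: matrix_vector_mult_def sum_product mult_ac)
  also have "\<dots> = (\<Sum>i\<in>UNIV. \<Sum>n\<in>UNIV. \<Sum>j\<in>UNIV. a $ i * cnj (b $ j) * (P $ n $ i * cnj (P $ n $ j)))"
    by (rule sum.swap)
  also have "\<dots> = (\<Sum>i\<in>UNIV. \<Sum>j\<in>UNIV. \<Sum>n\<in>UNIV. a $ i * cnj (b $ j) * (P $ n $ i * cnj (P $ n $ j)))"
    by (intro sum.cong refl sum.swap)
  also have "\<dots> = (\<Sum>i\<in>UNIV. \<Sum>j\<in>UNIV. a $ i * cnj (b $ j) * (transpose P ** cnj_mat P) $ i $ j)"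
    by (simp add: matrix_matrix_mult_def transpose_def cnj_mat_def sum_distrib_left)
  finally show ?thesis .
qed

text \<open>In the coordinates \<open>M *v v\<close>, which are purely imaginary on the subspace,
  \<open>omega\<close> becomes a real bilinear form with matrix Im G. So it vanishes iff
  \<open>G\<close> is real, which holds iff its inverse \<open>H\<close> is real; \<open>H\<close>
  avoids inverting \<open>M\<close>.\<close>

lemma omega_vanishes_iff:
  fixes M :: "complex ^ 'n ^ 'n"
  assumes "invertible M"
  shows "(\<forall>v\<in>{v. M *v v \<in> imaginary_vectors}. \<forall>w\<in>{v. M *v v \<in> imaginary_vectors}. omega v w = 0)
    \<longleftrightarrow> (\<forall>m n. Im ((cnj_mat M ** transpose M) $ m $ n) = 0)" (is "?lhs \<longleftrightarrow> ?rhs")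
proof -
  obtain P where MP: "M ** P = mat 1" and PM: "P ** M = mat 1"
    using assms unfolding invertible_def by blast
  define G where "G = transpose P ** cnj_mat P"
  define H where "H = cnj_mat M ** transpose M"
  have "transpose M ** transpose P = mat 1"
    using PM by (metis matrix_transpose_mul transpose_mat)
  moreover have "cnj_mat M ** cnj_mat P = mat 1"
    using MP by (metis cnj_mat_mult cnj_mat_one)
  ultimately have HG: "H ** G = mat 1"
    unfolding G_def H_def by (metis matrix_mul_assoc matrix_mul_rid)
  then have GH: "G ** H = mat 1" using matrix_left_right_inverse by blast
  have omega_G: "omega v w = complex_of_real (Im (\<Sum>i\<in>UNIV. \<Sum>j\<in>UNIV. (M *v v) $ i * cnj ((M *v w) $ j) * G $ i $ j))"
    for v w
    using hermitian_product_mult[of P "M *v v" "M *v w"]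
    by (simp add: omega_eq G_def matrix_vector_mul_assoc PM)
  have "?lhs \<longleftrightarrow> cnj_mat G = G"
  proof
    assume L: ?lhs
    have "Im (G $ i $ j) = 0" for i j
    proof -
      \<comment> \<open>Preimages of the vectors i e_k, a real basis of
        \<open>imaginary_vectors\<close>. Since i conj(i) = 1, the double sum at \<open>v i\<close>,
        \<open>v j\<close> reduces to the entry of \<open>G\<close>.\<close>
      define v where "v k = P *v axis k \<i>" for k
      have v: "M *v v k = axis k \<i>" for k by (simp add: v_def matrix_vector_mul_assoc MP)
      then have "omega (v i) (v j) = 0"
        using L by (auto simp: imaginary_vectors_def axis_def)
      moreover have "(\<Sum>k\<in>UNIV. \<Sum>l\<in>UNIV. (M *v v i) $ k * cnj ((M *v v j) $ l) * G $ k $ l) = G $ i $ j"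
        by (simp add: v axis_def if_distrib[of cnj] if_distrib[of "(*) _"]
            if_distrib[of "\<lambda>x. x * _"] sum_negf cong: if_cong)
      ultimately show ?thesis using omega_G[of "v i" "v j"] by simp
    qed
    then show "cnj_mat G = G" by (simp add: cnj_mat_eq_iff)
  next
    assume "cnj_mat G = G"
    then show ?lhs unfolding cnj_mat_eq_iff by (auto simp: omega_G imaginary_vectors_def)
  qed
  also have "\<dots> \<longleftrightarrow> cnj_mat H = H" using GH HG cnj_mat_inverse by blast
  finally show ?thesis by (simp add: cnj_mat_eq_iff H_def)
qed

section \<open>Values of Omega and its phase\<close>

lemma Omega_eq:
  fixes M :: "complex ^ 'n ^ 'n"
  assumes "invertible M" "\<And>j. M *v vs j \<in> imaginary_vectors"
  shows "Omega vs = \<i> ^ CARD('n) / det M * complex_of_real (det (\<chi> m j. Im ((M *v vs j) $ m)))"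
proof -
  define X where "X = (\<chi> n j. vs j $ n)"
  \<comment> \<open>With the arguments as columns of \<open>X\<close>, the matrix M X is i times a
    real matrix; its determinant yields one factor i per row.\<close>
  have "M ** X = (\<chi> m. \<i> *s (\<chi> j. complex_of_real (Im ((M *v vs j) $ m))))"
    using assms(2) by (simp add: X_def vec_eq_iff matrix_matrix_mult_def matrix_vector_mult_def
        imaginary_vectors_def complex_eq_iff)
  then have "det M * det X = \<i> ^ CARD('n) * det (\<chi> m j. complex_of_real (Im ((M *v vs j) $ m)))"
    using det_rows_mul[of "\<lambda>_. \<i>" "\<lambda>m. \<chi> j. complex_of_real (Im ((M *v vs j) $ m))"] by (simp flip: det_mul)
  moreover have "det M \<noteq> 0" using assms(1) invertible_det_nz by blast
  ultimately show ?thesis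
    by (simp add: Omega_def wedge_all_def du_def X_def det_of_real field_simps)
qed

text \<open>All values of \<open>Omega\<close> on the subspace are real multiples of i^d / det M,
  and the preimages of the i e_j attain this number itself.\<close>

lemma Im_Omega_vanishes_iff:
  fixes M :: "complex ^ 'n ^ 'n"
  assumes "invertible M"
  shows "(\<forall>vs. (\<forall>j. vs j \<in> {v. M *v v \<in> imaginary_vectors}) \<longrightarrow> Im (Omega vs) = 0)
    \<longleftrightarrow> Im (\<i> ^ CARD('n) / det M) = 0" (is "?lhs \<longleftrightarrow> ?rhs")
proof
  assume L: ?lhs
  obtain P where MP: "M ** P = mat 1" using assms unfolding invertible_def by blast
  define vs where "vs j = P *v axis j \<i>" for j
  have v: "M *v vs k = axis k \<i>" for k by (simp add: vs_def matrix_vector_mul_assoc MP)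
  have im: "M *v vs k \<in> imaginary_vectors" for k by (simp add: v imaginary_vectors_def axis_def)
  have "(\<chi> m j. Im ((M *v vs j) $ m)) = mat 1" by (simp add: v axis_def mat_def vec_eq_iff)
  then have "Omega vs = \<i> ^ CARD('n) / det M" using Omega_eq[OF assms im] by simp
  moreover have "Im (Omega vs) = 0" using L im by blast
  ultimately show ?rhs by simp
next
  assume ?rhs
  show ?lhs
  proof (intro allI impI)
    fix vs :: "'n \<Rightarrow> complex ^ 'n"
    assume "\<forall>j. vs j \<in> {v. M *v v \<in> imaginary_vectors}"
    then have "Omega vs = \<i> ^ CARD('n) / det M * complex_of_real (det (\<chi> m j. Im ((M *v vs j) $ m)))"
      by (intro Omega_eq[OF assms]) auto
    then show "Im (Omega vs) = 0"
      using \<open>?rhs\<close> by (simp only: times_complex.sel Im_complex_of_real)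
  qed
qed

section \<open>From M to det N and the Poisson brackets\<close>

lemma det_scaleR: "det (c *\<^sub>R (A :: complex ^ 'n ^ 'n)) = complex_of_real c ^ CARD('n) * det A"
proof -
  have "c *\<^sub>R A = (\<chi> i. complex_of_real c *s A $ i)"
    by (simp add: vec_eq_iff complex_eq_iff)
  then show ?thesis
    using det_rows_mul[of "\<lambda>_. complex_of_real c" "\<lambda>i. A $ i"] by simp
qed

text \<open>A number is real iff it equals its conjugate, and conj (i^d) = (-1)^d i^d; cancelling
  i^d leaves the phase condition.\<close>

lemma Im_i_power_divide_eq_0_iff:
  assumes "D \<noteq> (0::complex)"
  shows "Im (\<i> ^ d / D) = 0 \<longleftrightarrow> (-1) ^ d * (D / cnj D) = 1"
proof -
  have "Im z = 0 \<longleftrightarrow> cnj z = z" for z by (simp add: complex_eq_iff)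
  then have "Im (\<i> ^ d / D) = 0 \<longleftrightarrow> cnj (\<i> ^ d / D) = \<i> ^ d / D" .
  also have "cnj (\<i> ^ d / D) = \<i> ^ d * ((-1) ^ d / cnj D)"
    by (simp add: power_mult_distrib[symmetric])
  also have "\<dots> = \<i> ^ d / D \<longleftrightarrow> (-1) ^ d * (D / cnj D) = 1"
    using assms by (simp add: field_simps)
  finally show ?thesis .
qed

lemma Mbar_mat_eq: "Mbar_mat f x = cnj_mat (M_mat f x)"
  by (simp add: Mbar_mat_def M_mat_def cnj_mat_def wirtinger_def wirtinger_bar_def vec_eq_iff complex_eq_iff)

lemma matrix_inv_inverse: "invertible A \<Longrightarrow> matrix_inv A ** A = mat 1"
  unfolding invertible_def matrix_inv_def by (rule someI2_ex) auto

lemma det_N_mat: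
  fixes f :: "'n::finite \<Rightarrow> complex ^ 'n \<Rightarrow> real"
  assumes "invertible (M_mat f x)"
  shows "det (N_mat f x) = (-1) ^ CARD('n) * (det (M_mat f x) / cnj (det (M_mat f x)))"
proof -
  have nz: "det (Mbar_mat f x) \<noteq> 0"
    using assms by (simp add: Mbar_mat_eq det_cnj_mat invertible_det_nz)
  then have "det (matrix_inv (Mbar_mat f x)) * det (Mbar_mat f x) = 1"
    by (metis det_I det_mul invertible_det_nz matrix_inv_inverse)
  then have "det (matrix_inv (Mbar_mat f x)) = 1 / cnj (det (M_mat f x))"
    using nz by (simp add: Mbar_mat_eq det_cnj_mat field_simps)
  \<comment> \<open>The scalar (-1)^d of \<open>N_mat\<close> enters the determinant once per row,
    and d^2 has the parity of d.\<close>
  moreover have "((-1::complex) ^ CARD('n)) ^ CARD('n) = (-1) ^ CARD('n)"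
    by (cases "even CARD('n)") auto
  ultimately show ?thesis by (simp add: N_mat_def det_scaleR det_mul)
qed

text \<open>Writing a, b and c, e for the real partials of \<open>f m\<close> and
  \<open>f n\<close>, each summand is (a + i b)(c - i e) / 4, whose imaginary part is -(a e - b c) /
  4.\<close>

lemma Im_Mbar_M_transpose:
  "Im ((cnj_mat (M_mat f x) ** transpose (M_mat f x)) $ m $ n) = - poisson (f m) (f n) x / 4"
proof -
  have "Im (cnj (wirtinger k (f m) x) * wirtinger k (f n) x)
      = - (partial_re k (f m) x * partial_im k (f n) x - partial_im k (f m) x * partial_re k (f n) x) / 4" for k
    by (simp add: wirtinger_def field_simps)
  moreover have "Im ((cnj_mat (M_mat f x) ** transpose (M_mat f x)) $ m $ n)
      = (\<Sum>k\<in>UNIV. Im (cnj (wirtinger k (f m) x) * wirtinger k (f n) x))"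
    by (simp add: cnj_mat_def M_mat_def transpose_def matrix_matrix_mult_def del: times_complex.sel)
  ultimately show ?thesis
    by (simp only: poisson_def sum_negf[symmetric] sum_divide_distrib)
qed

subsection \<open>The criterion\<close>

theorem mainTheorem2:
  fixes f :: "'n::finite \<Rightarrow> complex ^ 'n \<Rightarrow> real"
    and \<Sigma> :: "(complex ^ 'n) set"
  assumes smooth: "\<And>m. smooth_on UNIV (f m)"
    and Sigma: "\<Sigma> = {x. \<forall>m. f m x = 0}"
    and inv: "\<And>x. x \<in> \<Sigma> \<Longrightarrow> invertible (M_mat f x)"
  shows "supersymmetric \<Sigma> \<longleftrightarrow>
         (\<forall>x\<in>\<Sigma>. (\<forall>m n. poisson (f m) (f n) x = 0) \<and> det (N_mat f x) = 1)"
proof -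
  interpret smooth_family f by standard (rule smooth)
  have zs: "\<Sigma> = zero_set" by (simp add: Sigma zero_set_def)
  have omega: "(\<forall>v\<in>tangent_space \<Sigma> p. \<forall>w\<in>tangent_space \<Sigma> p. omega v w = 0)
      \<longleftrightarrow> (\<forall>m n. poisson (f m) (f n) p = 0)" if "p \<in> \<Sigma>" for p
    using omega_vanishes_iff[OF inv[OF that]] tangent_space_zero_set[of p] inv[OF that] that
    by (simp add: zs Im_Mbar_M_transpose)
  have Omega: "(\<forall>vs. (\<forall>j. vs j \<in> tangent_space \<Sigma> p) \<longrightarrow> Im (Omega vs) = 0)
      \<longleftrightarrow> det (N_mat f p) = 1" if "p \<in> \<Sigma>" for p
  proof -
    have "det (M_mat f p) \<noteq> 0" using inv[OF that] invertible_det_nz by blast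
    then show ?thesis
      using Im_Omega_vanishes_iff[OF inv[OF that]] tangent_space_zero_set[of p] inv[OF that] that
      by (simp add: zs det_N_mat Im_i_power_divide_eq_0_iff)
  qed
  \<comment> \<open>The submanifold clause of \<open>supersymmetric\<close> follows from
    invertibility of \<open>M\<close>, so the two pointwise equivalences settle both
    directions.\<close>
  have "embedded_submanifold CARD('n) \<Sigma>"
    using embedded_submanifold_zero_set inv zs by blast
  then show ?thesis unfolding supersymmetric_def using omega Omega by blast
qed

end
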